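(* Let $\epsilon\in\{1,-1\}$, let $\gamma\in\mathbb{R}$ with $\gamma\neq 0$, and consider the equation $$i\psi_t+\psi_{xx}+(\epsilon+i\gamma)\frac{1}{x}|\psi|^2\psi+\frac{5}{36}\,\frac{1}{x^2}\,\psi=0,\qquad x\in\mathbb{R}\setminus\{0\}. \qquad ( * )$$ For any $T>0$ there is a solution $\psi(x,t)$ of $( * )$ on $(\mathbb{R}\setminus\{0\})\times[0,T)$ such that $$\lim_{t\to T^-}\|\psi(\cdot,t)\|_\infty=\infty,$$ where $\|\psi(\cdot,t)\|_\infty=\operatorname{ess\,sup}_{x\in[0,\infty)}|\psi(x,t)|$ for $t<T$.
   Context: The unknown $\psi=\psi(x,t)$ is complex-valued. A solution means a pointwise solution in the classical sense. No initial condition is prescribed: the solution may have whatever initial value $\psi(x,0)$ it has. *)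

theory Defs
  imports "HOL-Analysis.Analysis" "HOL-Probability.Essential_Supremum"
begin

text \<open>
  Classical solutions of
  \<open>i \<psi>\<^sub>t + \<psi>\<^sub>x\<^sub>x + (\<epsilon> + i \<gamma>) (1/x) |\<psi>|\<^sup>2 \<psi> + (5/36) (1/x\<^sup>2) \<psi> = 0\<close> on \<open>(\<real> - {0}) \<times> [0,T)\<close>:
  the derivatives \<open>\<psi>\<^sub>t\<close>, \<open>\<psi>\<^sub>x\<close>, \<open>\<psi>\<^sub>x\<^sub>x\<close> exist at every point of the domain, are jointly continuous there
  together with \<open>\<psi>\<close>, and satisfy the equation at every point. At \<open>t = 0\<close> the time derivative is
  one-sided. The values of \<open>\<psi>\<close> at \<open>x = 0\<close> and outside the time interval are irrelevant.
\<close>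

definition classical_solution ::
  "real \<Rightarrow> real \<Rightarrow> real \<Rightarrow> (real \<Rightarrow> real \<Rightarrow> complex) \<Rightarrow> bool" where
  "classical_solution \<epsilon> \<gamma> T \<psi> \<longleftrightarrow>
    (\<exists>\<psi>t \<psi>x \<psi>xx :: real \<Rightarrow> real \<Rightarrow> complex.
      continuous_on ((- {0}) \<times> {0..<T}) (\<lambda>(x, t). \<psi> x t) \<and>
      continuous_on ((- {0}) \<times> {0..<T}) (\<lambda>(x, t). \<psi>t x t) \<and>
      continuous_on ((- {0}) \<times> {0..<T}) (\<lambda>(x, t). \<psi>x x t) \<and>
      continuous_on ((- {0}) \<times> {0..<T}) (\<lambda>(x, t). \<psi>xx x t) \<and>
      (\<forall>x\<in>- {0}. \<forall>t\<in>{0..<T}.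
        ((\<lambda>s. \<psi> x s) has_vector_derivative \<psi>t x t) (at t within {0..<T}) \<and>
        ((\<lambda>y. \<psi> y t) has_vector_derivative \<psi>x x t) (at x) \<and>
        ((\<lambda>y. \<psi>x y t) has_vector_derivative \<psi>xx x t) (at x) \<and>
        \<i> * \<psi>t x t + \<psi>xx x t
          + (complex_of_real \<epsilon> + \<i> * complex_of_real \<gamma>) * complex_of_real (1 / x)
              * complex_of_real ((cmod (\<psi> x t))\<^sup>2) * \<psi> x t
          + complex_of_real (5 / 36) * complex_of_real (1 / x\<^sup>2) * \<psi> x t = 0))"

text \<open>
  The essential supremum over the half-line \<open>[0,\<infinity>)\<close> with respect to Lebesgue measure.
\<close>

definition Linf_norm :: "(real \<Rightarrow> complex) \<Rightarrow> ereal" where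
  "Linf_norm u = esssup (lebesgue_on {0..}) (\<lambda>x. ereal (cmod (u x)))"

end

theory Submission
  imports Defs
begin

text \<open>
  The equation is scale invariant at the \<open>L\<^sup>2\<close> level: both potentials \<open>|\<psi>|\<^sup>2/x\<close> and
  \<open>5/(36 x\<^sup>2)\<close> have the weight of \<open>\<partial>\<^sub>x\<^sup>2\<close> when \<open>\<psi>\<close> has weight \<open>1/2\<close>. It is therefore
  pseudo-conformally invariant, exactly as for the mass-critical nonlinear Schroedinger equation,
  and every steady state \<open>Q\<close> on the half-line yields the solution
  \<open>\<tau>\<^sup>-\<^sup>1\<^sup>/\<^sup>2 exp(-i x\<^sup>2/(4\<tau>)) Q(x/\<tau>)\<close> with \<open>\<tau> = T - t\<close>. If \<open>Q\<close> is bounded and nonzero, its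
  supremum norm grows like \<open>\<tau>\<^sup>-\<^sup>1\<^sup>/\<^sup>2\<close>. Since the origin is removed, the two half-lines do not
  interact, and the solution may be taken to vanish for negative \<open>x\<close>.

  It remains to find a bounded steady state. The number \<open>5/36\<close> makes \<open>1/6\<close> and \<open>5/6\<close> the exponents
  of the linear part at the origin, and with it the substitution \<open>Q(s) = s\<^sup>1\<^sup>/\<^sup>6 w(s\<^sup>2\<^sup>/\<^sup>3)\<close> turns the
  steady equation into the autonomous equation \<open>w'' + (9/4)(\<epsilon> + i\<gamma>)|w|\<^sup>2 w = 0\<close>. The latter is
  invariant under translations and scaling, and has the solutions \<open>w(y) = A (1 + y)\<^sup>-\<^sup>1\<^sup>+\<^sup>i\<^sup>\<beta>\<close> as soon as
  \<open>\<beta>\<^sup>2 - 2 = (9/4) \<epsilon> A\<^sup>2\<close> and \<open>3 \<beta> = (9/4) \<gamma> A\<^sup>2\<close>. This system has a solution with \<open>A > 0\<close>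
  because \<open>\<gamma> \<noteq> 0\<close>. The shift by \<open>1\<close> moves the singularity of the power away from the half-line, so
  that \<open>|Q(s)| = A s\<^sup>1\<^sup>/\<^sup>6 / (1 + s\<^sup>2\<^sup>/\<^sup>3)\<close> is bounded.

  The lemmas \<open>pseudoconformal_classical_solution\<close>, \<open>steady_state_of_autonomous\<close>,
  \<open>autonomous_power_solution\<close> and \<open>amplitude_phase_exist\<close> carry these steps.
\<close>

section \<open>Derivative rules for complex-valued functions of a real variable\<close>

lemma has_vector_derivative_exp:
  fixes g :: "real \<Rightarrow> complex"
  assumes "(g has_vector_derivative g') (at x within S)"
  shows "((\<lambda>y. exp (g y)) has_vector_derivative g' * exp (g x)) (at x within S)"
  using field_vector_diff_chain_within[OF assms, of exp "exp (g x)"]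
  by (simp add: o_def DERIV_exp has_field_derivative_at_within)

lemma has_vector_derivative_powr_scaled:
  fixes u :: "real \<Rightarrow> complex"
  assumes "s > 0" and u: "(u has_vector_derivative u') (at s)"
  shows "((\<lambda>s. s powr a *\<^sub>R u s) has_vector_derivative
           (a * s powr (a - 1)) *\<^sub>R u s + s powr a *\<^sub>R u') (at s)"
proof -
  have "((\<lambda>s. s powr a) has_real_derivative a * s powr (a - 1)) (at s)"
    using has_real_derivative_powr[OF \<open>s > 0\<close>, of a] by simp
  from has_vector_derivative_scaleR[OF this u] show ?thesis
    by (simp add: add.commute)
qed

lemma has_vector_derivative_compose_powr:
  fixes u :: "real \<Rightarrow> complex"
  assumes "s > 0" and u: "(u has_vector_derivative u') (at (s powr b))"
  shows "((\<lambda>s. u (s powr b)) has_vector_derivative (b * s powr (b - 1)) *\<^sub>R u') (at s)"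
proof -
  have "((\<lambda>s. s powr b) has_vector_derivative b * s powr (b - 1)) (at s)"
    using has_real_derivative_powr[OF \<open>s > 0\<close>, of b]
    by (simp add: has_real_derivative_iff_has_vector_derivative)
  from vector_diff_chain_at[OF this u] show ?thesis
    by (simp add: o_def)
qed

section \<open>A bounded steady state on the half-line\<close>

text \<open>
  An Emden--Fowler substitution. The factor \<open>s\<^sup>1\<^sup>/\<^sup>6\<close> solves the linear equation
  \<open>Q'' + 5/(36 s\<^sup>2) Q = 0\<close>, and \<open>s\<^sup>2\<^sup>/\<^sup>3\<close> is the ratio of its two power solutions.
\<close>

definition emden :: "(real \<Rightarrow> complex) \<Rightarrow> real \<Rightarrow> complex" where
  "emden w = (\<lambda>s. s powr (1/6) *\<^sub>R w (s powr (2/3)))"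

text \<open>
  In the second derivative of \<open>s\<^sup>1\<^sup>/\<^sup>6 w(s\<^sup>2\<^sup>/\<^sup>3)\<close> the two contributions of \<open>w'\<close> carry the power
  \<open>s\<^sup>-\<^sup>7\<^sup>/\<^sup>6\<close> with coefficients \<open>1/9\<close> and \<open>-1/9\<close>, and cancel; the contribution of \<open>w\<close> is
  cancelled by the inverse-square potential. What is left of the linear part is
  \<open>(4/9) s\<^sup>-\<^sup>1\<^sup>/\<^sup>2 w''\<close>, and the cubic term has the same power of \<open>s\<close>.
\<close>

lemma steady_state_of_autonomous:
  fixes w w1 w2 :: "real \<Rightarrow> complex" and c :: complex
  defines "Q \<equiv> emden w"
    and "Q1 \<equiv> \<lambda>s. (1/6 * s powr (-5/6)) *\<^sub>R w (s powr (2/3))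
                + (2/3 * s powr (-1/6)) *\<^sub>R w1 (s powr (2/3))"
    and "Q2 \<equiv> \<lambda>s. (-5/36 * s powr (-11/6)) *\<^sub>R w (s powr (2/3))
                + (4/9 * s powr (-1/2)) *\<^sub>R w2 (s powr (2/3))"
  assumes w: "\<And>y. y > 0 \<Longrightarrow> (w has_vector_derivative w1 y) (at y)"
    and w1: "\<And>y. y > 0 \<Longrightarrow> (w1 has_vector_derivative w2 y) (at y)"
    and eq: "\<And>y. y > 0 \<Longrightarrow> w2 y + 9/4 * c * complex_of_real ((cmod (w y))\<^sup>2) * w y = 0"
    and s: "s > 0"
  shows "(Q has_vector_derivative Q1 s) (at s)"
    and "(Q1 has_vector_derivative Q2 s) (at s)"
    and "Q2 s + c * complex_of_real (1 / s) * complex_of_real ((cmod (Q s))\<^sup>2) * Q s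
           + complex_of_real (5/36) * complex_of_real (1 / s\<^sup>2) * Q s = 0"
proof -
  have y: "s powr (2/3) > 0" using s by simp
  note dw = has_vector_derivative_compose_powr[OF s w[OF y]]
  note dw1 = has_vector_derivative_compose_powr[OF s w1[OF y]]
  have pw: "s powr a * s powr b = s powr (a + b)" for a b
    by (simp add: powr_add)
  show "(Q has_vector_derivative Q1 s) (at s)"
    unfolding Q_def emden_def Q1_def
    by (rule has_vector_derivative_eq_rhs[OF has_vector_derivative_powr_scaled[OF s dw]])
       (simp add: pw mult.left_commute)
  have "((\<lambda>s. (1/6) *\<^sub>R (s powr (-5/6) *\<^sub>R w (s powr (2/3)))
           + (2/3) *\<^sub>R (s powr (-1/6) *\<^sub>R w1 (s powr (2/3)))) has_vector_derivative Q2 s) (at s)"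
    unfolding Q2_def
    by (rule has_vector_derivative_eq_rhs[OF has_vector_derivative_add
          [OF bounded_linear.has_vector_derivative[OF bounded_linear_scaleR_right, OF has_vector_derivative_powr_scaled[OF s dw]]
              bounded_linear.has_vector_derivative[OF bounded_linear_scaleR_right, OF has_vector_derivative_powr_scaled[OF s dw1]]]])
       (simp add: pw mult.left_commute, simp add: scaleR_conv_of_real algebra_simps)
  then show "(Q1 has_vector_derivative Q2 s) (at s)"
    unfolding Q1_def by simp
  have Q2': "w2 (s powr (2/3)) = - (9/4 * c * complex_of_real ((cmod (w (s powr (2/3))))\<^sup>2) * w (s powr (2/3)))"
    using eq[OF y] by (simp add: eq_neg_iff_add_eq_0)
  have nQ: "(cmod (Q s))\<^sup>2 = s powr (1/3) * (cmod (w (s powr (2/3))))\<^sup>2"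
    by (simp add: Q_def emden_def power_mult_distrib power2_eq_square[of "s powr _"] pw)
  have e1: "1 / s * s powr (1/3) * s powr (1/6) = s powr (-1/2)"
  proof -
    have "1 / s = s powr (-1)" using s by (simp add: powr_minus_divide)
    then show ?thesis by (simp only: pw) simp
  qed
  have e2: "1 / s\<^sup>2 * s powr (1/6) = s powr (-11/6)"
  proof -
    have "1 / s\<^sup>2 = s powr (-2)" using s by (simp add: powr_minus_divide powr_numeral)
    then show ?thesis by (simp only: pw) simp
  qed
  have "c * complex_of_real (1 / s) * complex_of_real ((cmod (Q s))\<^sup>2) * Q s
     = c * complex_of_real (1 / s * s powr (1/3) * s powr (1/6))
         * complex_of_real ((cmod (w (s powr (2/3))))\<^sup>2) * w (s powr (2/3))"
    unfolding nQ by (simp add: Q_def emden_def scaleR_conv_of_real)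
  moreover have "complex_of_real (5/36) * complex_of_real (1 / s\<^sup>2) * Q s
     = complex_of_real (5/36) * complex_of_real (1 / s\<^sup>2 * s powr (1/6)) * w (s powr (2/3))"
    by (simp add: Q_def emden_def scaleR_conv_of_real)
  ultimately show "Q2 s + c * complex_of_real (1 / s) * complex_of_real ((cmod (Q s))\<^sup>2) * Q s
           + complex_of_real (5/36) * complex_of_real (1 / s\<^sup>2) * Q s = 0"
    unfolding e1 e2 by (simp add: Q2_def Q2' scaleR_conv_of_real)
qed

text \<open>The complex power \<open>A (1 + y)\<^sup>k\<close>.\<close>

definition power_profile :: "real \<Rightarrow> complex \<Rightarrow> real \<Rightarrow> complex" where
  "power_profile A k y = complex_of_real A * exp (k * complex_of_real (ln (1 + y)))"

lemma norm_power_profile: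
  assumes "y > -1"
  shows "cmod (power_profile A (Complex (-1) \<beta>) y) = \<bar>A\<bar> / (1 + y)"
  using assms by (simp add: power_profile_def norm_mult exp_minus divide_inverse)

text \<open>
  For \<open>k = -1 + i\<beta>\<close> the cubic term \<open>|w|\<^sup>2 w\<close> has the exponent \<open>k - 2\<close>, as has \<open>w''\<close>, so the
  differential equation reduces to one algebraic condition on the coefficients.
\<close>

lemma autonomous_power_solution:
  fixes A \<beta> :: real and c :: complex
  defines "\<kappa> \<equiv> Complex (-1) \<beta>"
  defines "w \<equiv> power_profile A"
  assumes c: "\<kappa> * (\<kappa> - 1) + 9/4 * c * complex_of_real (A\<^sup>2) = 0" and y: "y > 0"
  shows "(w \<kappa> has_vector_derivative \<kappa> * w (\<kappa> - 1) y) (at y)"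
    and "((\<lambda>y. \<kappa> * w (\<kappa> - 1) y) has_vector_derivative \<kappa> * (\<kappa> - 1) * w (\<kappa> - 2) y) (at y)"
    and "\<kappa> * (\<kappa> - 1) * w (\<kappa> - 2) y
           + 9/4 * c * complex_of_real ((cmod (w \<kappa> y))\<^sup>2) * w \<kappa> y = 0"
proof -
  have shift: "w (k - 1) y = w k y / complex_of_real (1 + y)" for k
    using y by (simp add: w_def power_profile_def algebra_simps exp_diff exp_of_real)
  have dw: "(w k has_vector_derivative k * w (k - 1) y) (at y)" for k
  proof -
    have "((\<lambda>y. ln (1 + y)) has_real_derivative 1 / (1 + y)) (at y)"
      using y by (auto intro!: derivative_eq_intros)
    then have "((\<lambda>y. complex_of_real (ln (1 + y))) has_vector_derivative complex_of_real (1 / (1 + y))) (at y)"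
      by (rule has_vector_derivative_of_real)
    then have "((\<lambda>y. k * complex_of_real (ln (1 + y))) has_vector_derivative k * complex_of_real (1 / (1 + y))) (at y)"
      by (rule has_vector_derivative_mult_right)
    from has_vector_derivative_mult_right[OF has_vector_derivative_exp[OF this], of "complex_of_real A"]
    show ?thesis unfolding shift by (simp add: w_def power_profile_def[abs_def] mult_ac)
  qed
  show "(w \<kappa> has_vector_derivative \<kappa> * w (\<kappa> - 1) y) (at y)" by (rule dw)
  show "((\<lambda>y. \<kappa> * w (\<kappa> - 1) y) has_vector_derivative \<kappa> * (\<kappa> - 1) * w (\<kappa> - 2) y) (at y)"
    using has_vector_derivative_mult_right[OF dw[of "\<kappa> - 1"], of \<kappa>] by (simp add: mult_ac)
  have "cmod (w \<kappa> y) = \<bar>A\<bar> / (1 + y)"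
    using y by (simp add: w_def \<kappa>_def norm_power_profile)
  then have n: "(cmod (w \<kappa> y))\<^sup>2 = A\<^sup>2 / (1 + y)\<^sup>2"
    by (simp add: power_divide)
  have "w (\<kappa> - 2) y = w \<kappa> y / complex_of_real ((1 + y)\<^sup>2)"
    using shift[of "\<kappa> - 1"] shift[of \<kappa>] by (simp add: power2_eq_square)
  then have "\<kappa> * (\<kappa> - 1) * w (\<kappa> - 2) y + 9/4 * c * complex_of_real ((cmod (w \<kappa> y))\<^sup>2) * w \<kappa> y
     = (\<kappa> * (\<kappa> - 1) + 9/4 * c * complex_of_real (A\<^sup>2)) * (w \<kappa> y / complex_of_real ((1 + y)\<^sup>2))"
    unfolding n by (simp add: add_divide_distrib ring_distribs(2) del: of_real_add)
  then show "\<kappa> * (\<kappa> - 1) * w (\<kappa> - 2) y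
           + 9/4 * c * complex_of_real ((cmod (w \<kappa> y))\<^sup>2) * w \<kappa> y = 0"
    using c by simp
qed

text \<open>
  With \<open>A\<^sup>2 = 4r/3\<close> the imaginary part of the condition says \<open>\<beta> = \<gamma> r\<close>, and the real part becomes
  \<open>\<gamma>\<^sup>2 r\<^sup>2 - 3 \<epsilon> r - 2 = 0\<close>. The roots of this quadratic have the negative product \<open>-2/\<gamma>\<^sup>2\<close>, so
  one of them is positive.
\<close>

lemma amplitude_phase_exist:
  fixes \<epsilon> \<gamma> :: real
  assumes "\<gamma> \<noteq> 0"
  obtains A \<beta> :: real where "A > 0"
    "Complex (-1) \<beta> * (Complex (-1) \<beta> - 1)
       + 9/4 * (complex_of_real \<epsilon> + \<i> * complex_of_real \<gamma>) * complex_of_real (A\<^sup>2) = 0"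
proof -
  define r where "r = (3 * \<epsilon> + sqrt (9 * \<epsilon>\<^sup>2 + 8 * \<gamma>\<^sup>2)) / (2 * \<gamma>\<^sup>2)"
  have "sqrt (9 * \<epsilon>\<^sup>2 + 8 * \<gamma>\<^sup>2) > sqrt ((3 * \<epsilon>)\<^sup>2)"
    using assms by (intro real_sqrt_less_mono) (simp add: power_mult_distrib)
  then have "3 * \<epsilon> + sqrt (9 * \<epsilon>\<^sup>2 + 8 * \<gamma>\<^sup>2) > 0" unfolding real_sqrt_abs by linarith
  then have r: "r > 0" unfolding r_def using assms by (intro divide_pos_pos) auto
  have "(2 * \<gamma>\<^sup>2 * r - 3 * \<epsilon>)\<^sup>2 = 9 * \<epsilon>\<^sup>2 + 8 * \<gamma>\<^sup>2"
    using assms by (simp add: r_def)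
  then have "4 * \<gamma>\<^sup>2 * (\<gamma>\<^sup>2 * r\<^sup>2 - 3 * \<epsilon> * r - 2) = 0"
    by (simp add: power2_eq_square algebra_simps)
  then have q: "\<gamma>\<^sup>2 * r\<^sup>2 = 3 * \<epsilon> * r + 2" using assms by simp
  show thesis
  proof
    show "sqrt (4/3 * r) > 0" using r by simp
    show "Complex (-1) (\<gamma> * r) * (Complex (-1) (\<gamma> * r) - 1)
       + 9/4 * (complex_of_real \<epsilon> + \<i> * complex_of_real \<gamma>) * complex_of_real ((sqrt (4/3 * r))\<^sup>2) = 0"
      using r q by (simp add: complex_eq_iff power2_eq_square algebra_simps)
  qed
qed

section \<open>Extension by zero across the origin\<close>

text \<open>
  Removing the origin disconnects the line, and both pieces are relatively open. Regularity
  on the positive side is therefore all that the extension by zero requires.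
\<close>

lemma continuous_on_extend_zero:
  fixes f :: "real \<Rightarrow> real \<Rightarrow> complex"
  assumes "continuous_on ({0<..} \<times> S) (\<lambda>(x, t). f x t)"
  shows "continuous_on ((- {0}) \<times> S) (\<lambda>(x, t). if x > 0 then f x t else 0)"
proof -
  have split: "(- {0 :: real}) \<times> S = ({0<..} \<times> S) \<union> ({..<0} \<times> S)"
    by auto
  have o: "openin (top_of_set ((- {0 :: real}) \<times> S)) ({0<..} \<times> S)"
          "openin (top_of_set ((- {0 :: real}) \<times> S)) ({..<0} \<times> S)"
    by (intro openin_Times open_subset openin_subtopology_self; auto)+
  show ?thesis
    unfolding split
  proof (rule continuous_on_Un_local_open)
    show "openin (top_of_set ({0::real<..} \<times> S \<union> {..<0} \<times> S)) ({0<..} \<times> S)"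
      using o(1) unfolding split .
    show "openin (top_of_set ({0::real<..} \<times> S \<union> {..<0} \<times> S)) ({..<0} \<times> S)"
      using o(2) unfolding split .
    show "continuous_on ({0<..} \<times> S) (\<lambda>(x, t). if x > 0 then f x t else 0)"
      by (rule continuous_on_eq[OF assms]) auto
    show "continuous_on ({..<0} \<times> S) (\<lambda>(x, t). if x > 0 then f x t else 0)"
      by (rule continuous_on_eq[OF continuous_on_const[of _ 0]]) auto
  qed
qed

lemma has_vector_derivative_extend_zero:
  fixes f :: "real \<Rightarrow> complex"
  assumes "x \<noteq> 0" and "x > 0 \<Longrightarrow> (f has_vector_derivative f') (at x)"
  shows "((\<lambda>y. if y > 0 then f y else 0) has_vector_derivative (if x > 0 then f' else 0)) (at x)"
proof (cases "x > 0")
  case True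
  show ?thesis
    using has_vector_derivative_transform_within_open[OF assms(2)[OF True], of "{0<..}"] True
    by simp
next
  case False
  then have "x < 0" using assms(1) by simp
  have "((\<lambda>_. 0 :: complex) has_vector_derivative 0) (at x)" by simp
  from has_vector_derivative_transform_within_open[OF this, of "{..<0}"
      "\<lambda>y. if y > 0 then f y else 0"] \<open>x < 0\<close>
  show ?thesis by simp
qed

section \<open>The pseudo-conformal transformation\<close>

text \<open>
  The prefactor is \<open>\<tau>\<^sup>-\<^sup>1\<^sup>/\<^sup>2 exp(-i x\<^sup>2/(4\<tau>))\<close> for \<open>\<tau> = T - t > 0\<close>; written as a single exponential,
  its derivatives are its multiples by the derivatives of the exponent.
\<close>

definition pseudoconformal :: "real \<Rightarrow> (real \<Rightarrow> complex) \<Rightarrow> real \<Rightarrow> real \<Rightarrow> complex" where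
  "pseudoconformal T Q x t =
     (if x > 0 then exp (complex_of_real (- ln (T - t) / 2) - \<i> * complex_of_real (x\<^sup>2 / (4 * (T - t))))
        * Q (x / (T - t)) else 0)"

text \<open>
  Let \<open>E\<close> be the prefactor. In \<open>i \<psi>\<^sub>t + \<psi>\<^sub>x\<^sub>x\<close> all the terms with \<open>Q\<close> and \<open>Q'\<close> cancel, which leaves
  \<open>E \<tau>\<^sup>-\<^sup>2 Q''(x/\<tau>)\<close>. The two potential terms also equal \<open>E \<tau>\<^sup>-\<^sup>2\<close> times the corresponding terms of
  the steady equation at \<open>x/\<tau>\<close>; for the cubic one this uses \<open>|E|\<^sup>2 = 1/\<tau>\<close>.
\<close>

lemma pseudoconformal_classical_solution:
  fixes Q Q1 Q2 :: "real \<Rightarrow> complex" and \<epsilon> \<gamma> T :: real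
  assumes Q: "\<And>s. s > 0 \<Longrightarrow> (Q has_vector_derivative Q1 s) (at s)"
    and Q1: "\<And>s. s > 0 \<Longrightarrow> (Q1 has_vector_derivative Q2 s) (at s)"
    and steady: "\<And>s. s > 0 \<Longrightarrow> Q2 s
          + (complex_of_real \<epsilon> + \<i> * complex_of_real \<gamma>) * complex_of_real (1 / s)
              * complex_of_real ((cmod (Q s))\<^sup>2) * Q s
          + complex_of_real (5/36) * complex_of_real (1 / s\<^sup>2) * Q s = 0"
  shows "classical_solution \<epsilon> \<gamma> T (pseudoconformal T Q)"
proof -
  let ?c = "complex_of_real \<epsilon> + \<i> * complex_of_real \<gamma>"
  let ?D = "{0<..} \<times> {0..<T}"
  define E where "E x t =
    exp (complex_of_real (- ln (T - t) / 2) - \<i> * complex_of_real (x\<^sup>2 / (4 * (T - t))))" for x t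
  define px where "px x t = E x t * (- \<i> * complex_of_real (x / (2 * (T - t))) * Q (x / (T - t))
     + complex_of_real (1 / (T - t)) * Q1 (x / (T - t)))" for x t
  define pxx where "pxx x t = E x t *
     ((- complex_of_real (x\<^sup>2 / (4 * (T - t)\<^sup>2)) - \<i> * complex_of_real (1 / (2 * (T - t)))) * Q (x / (T - t))
     - \<i> * complex_of_real (x / (T - t)\<^sup>2) * Q1 (x / (T - t))
     + complex_of_real (1 / (T - t)\<^sup>2) * Q2 (x / (T - t)))" for x t
  define pt where "pt x t = E x t *
     (complex_of_real (1 / (2 * (T - t))) * Q (x / (T - t))
     - \<i> * complex_of_real (x\<^sup>2 / (4 * (T - t)\<^sup>2)) * Q (x / (T - t))
     + complex_of_real (x / (T - t)\<^sup>2) * Q1 (x / (T - t)))" for x t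
  have cQ: "continuous_on {0<..} Q" and cQ1: "continuous_on {0<..} Q1"
    using Q Q1 by (auto intro!: continuous_at_imp_continuous_on has_vector_derivative_continuous)
  \<comment> \<open>The continuity of the second derivative comes from the steady equation itself.\<close>
  have cQ2: "continuous_on {0<..} Q2"
  proof (rule continuous_on_eq)
    show "continuous_on {0<..} (\<lambda>s. - (?c * complex_of_real (1 / s) * complex_of_real ((cmod (Q s))\<^sup>2) * Q s
          + complex_of_real (5/36) * complex_of_real (1 / s\<^sup>2) * Q s))"
      by (intro continuous_intros cQ) auto
    show "- (?c * complex_of_real (1 / s) * complex_of_real ((cmod (Q s))\<^sup>2) * Q s
          + complex_of_real (5/36) * complex_of_real (1 / s\<^sup>2) * Q s) = Q2 s" if "s \<in> {0<..}" for s
      using steady[of s] that by (simp only: greaterThan_iff) (simp add: add_eq_0_iff2 add.assoc)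
  qed
  have comp: "continuous_on ?D (\<lambda>(x, t). F (x / (T - t)))" if "continuous_on {0<..} F"
    for F :: "real \<Rightarrow> complex"
    unfolding case_prod_beta
    by (rule continuous_on_compose2[OF that]) (auto intro!: continuous_intros)
  note cc = comp[OF cQ, unfolded case_prod_beta] comp[OF cQ1, unfolded case_prod_beta]
    comp[OF cQ2, unfolded case_prod_beta]
  have cE: "continuous_on ?D (\<lambda>p. E (fst p) (snd p))"
    unfolding E_def by (intro continuous_intros) auto
  have c0: "continuous_on ?D (\<lambda>(x, t). E x t * Q (x / (T - t)))"
    unfolding case_prod_beta by (intro continuous_intros cE cc)
  have cx: "continuous_on ?D (\<lambda>(x, t). px x t)"
    unfolding case_prod_beta px_def by (intro continuous_intros cE cc) auto
  have cxx: "continuous_on ?D (\<lambda>(x, t). pxx x t)"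
    unfolding case_prod_beta pxx_def by (intro continuous_intros cE cc) auto
  have ct: "continuous_on ?D (\<lambda>(x, t). pt x t)"
    unfolding case_prod_beta pt_def by (intro continuous_intros cE cc) auto

  have main: "((\<lambda>s. E x s * Q (x / (T - s))) has_vector_derivative pt x t) (at t)"
    "((\<lambda>y. E y t * Q (y / (T - t))) has_vector_derivative px x t) (at x)"
    "((\<lambda>y. px y t) has_vector_derivative pxx x t) (at x)"
    "\<i> * pt x t + pxx x t
          + ?c * complex_of_real (1 / x) * complex_of_real ((cmod (E x t * Q (x / (T - t))))\<^sup>2) * (E x t * Q (x / (T - t)))
          + complex_of_real (5 / 36) * complex_of_real (1 / x\<^sup>2) * (E x t * Q (x / (T - t))) = 0"
    if x: "x > 0" and t: "t < T" for x t
  proof -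
    have s: "x / (T - t) > 0" using x t by simp
    obtain \<tau> where \<tau>: "T - t = \<tau>" "\<tau> > 0" using t by simp
    have dsx: "((\<lambda>y. y / (T - t)) has_vector_derivative 1 / (T - t)) (at x)"
      unfolding has_real_derivative_iff_has_vector_derivative[symmetric]
      using t by (auto intro!: derivative_eq_intros)
    have frac: "((\<lambda>s. k / (T - s)) has_real_derivative k / (T - t)\<^sup>2) (at t)" for k
      using t by (auto intro!: derivative_eq_intros simp: power2_eq_square)
    then have dst: "((\<lambda>s. x / (T - s)) has_vector_derivative x / (T - t)\<^sup>2) (at t)"
      by (simp only: has_real_derivative_iff_has_vector_derivative)
    have dQx: "((\<lambda>y. Q (y / (T - t))) has_vector_derivative complex_of_real (1 / (T - t)) * Q1 (x / (T - t))) (at x)"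
      using vector_diff_chain_at[OF dsx Q[OF s]] by (simp add: o_def scaleR_conv_of_real)
    have dQ1x: "((\<lambda>y. Q1 (y / (T - t))) has_vector_derivative complex_of_real (1 / (T - t)) * Q2 (x / (T - t))) (at x)"
      using vector_diff_chain_at[OF dsx Q1[OF s]] by (simp add: o_def scaleR_conv_of_real)
    have dQt: "((\<lambda>s. Q (x / (T - s))) has_vector_derivative complex_of_real (x / (T - t)\<^sup>2) * Q1 (x / (T - t))) (at t)"
      using vector_diff_chain_at[OF dst Q[OF s]] by (simp add: o_def scaleR_conv_of_real)
    have a: "((\<lambda>y. y\<^sup>2 / (4 * (T - t))) has_real_derivative x / (2 * (T - t))) (at x)"
    proof -
      have "((\<lambda>y. y\<^sup>2) has_real_derivative 2 * x) (at x)"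
        by (auto intro!: derivative_eq_intros)
      from DERIV_cdivide[OF this, of "4 * (T - t)"]
      show ?thesis by (rule DERIV_cong) (use t in \<open>simp add: divide_simps\<close>)
    qed
    have b: "((\<lambda>s. x\<^sup>2 / (4 * (T - s))) has_real_derivative x\<^sup>2 / (4 * (T - t)\<^sup>2)) (at t)"
      using frac[of "x\<^sup>2 / 4"] by simp
    have d: "((\<lambda>s. - ln (T - s) / 2) has_real_derivative 1 / (2 * (T - t))) (at t)"
      using t by (auto intro!: derivative_eq_intros simp: field_simps)
    have lin: "((\<lambda>y. y / (2 * (T - t))) has_real_derivative 1 / (2 * (T - t))) (at x)"
      using t by (auto intro!: derivative_eq_intros)
    note ofr = has_vector_derivative_of_real
    have dEx: "((\<lambda>y. E y t) has_vector_derivative (0 - \<i> * complex_of_real (x / (2 * (T - t)))) * E x t) (at x)"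
      unfolding E_def
      by (intro has_vector_derivative_exp has_vector_derivative_diff has_vector_derivative_const
          has_vector_derivative_mult_right ofr a)
    have dEt: "((\<lambda>s. E x s) has_vector_derivative
        (complex_of_real (1 / (2 * (T - t))) - \<i> * complex_of_real (x\<^sup>2 / (4 * (T - t)\<^sup>2))) * E x t) (at t)"
      unfolding E_def
      by (intro has_vector_derivative_exp has_vector_derivative_diff
          has_vector_derivative_mult_right ofr b d)
    show "((\<lambda>s. E x s * Q (x / (T - s))) has_vector_derivative pt x t) (at t)"
      by (rule has_vector_derivative_eq_rhs[OF has_vector_derivative_mult[OF dEt dQt]])
         (simp only: pt_def ring_distribs mult_ac add_ac)
    show "((\<lambda>y. E y t * Q (y / (T - t))) has_vector_derivative px x t) (at x)"
      by (rule has_vector_derivative_eq_rhs[OF has_vector_derivative_mult[OF dEx dQx]])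
         (simp add: px_def algebra_simps)
    have dlin: "((\<lambda>y. - \<i> * complex_of_real (y / (2 * (T - t)))) has_vector_derivative
        - \<i> * complex_of_real (1 / (2 * (T - t)))) (at x)"
      by (intro has_vector_derivative_mult_right ofr lin)
    show "((\<lambda>y. px y t) has_vector_derivative pxx x t) (at x)"
      unfolding px_def
    proof (rule has_vector_derivative_eq_rhs[OF has_vector_derivative_mult[OF dEx
            has_vector_derivative_add[OF has_vector_derivative_mult[OF dlin dQx]
              has_vector_derivative_mult_right[OF dQ1x]]]])
      show "E x t * (- \<i> * complex_of_real (x / (2 * (T - t)))
                * (complex_of_real (1 / (T - t)) * Q1 (x / (T - t)))
              + - \<i> * complex_of_real (1 / (2 * (T - t))) * Q (x / (T - t))
              + complex_of_real (1 / (T - t)) * (complex_of_real (1 / (T - t)) * Q2 (x / (T - t))))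
          + (0 - \<i> * complex_of_real (x / (2 * (T - t)))) * E x t
              * (- \<i> * complex_of_real (x / (2 * (T - t))) * Q (x / (T - t))
                 + complex_of_real (1 / (T - t)) * Q1 (x / (T - t))) = pxx x t"
        unfolding pxx_def \<tau>(1) using \<tau>(2) by (simp add: field_simps power2_eq_square)
    qed
    have "cmod (E x t) = exp (- ln (T - t) / 2)"
      by (simp add: E_def)
    then have "(cmod (E x t))\<^sup>2 = exp (- ln (T - t))"
      by (simp add: power2_eq_square mult_exp_exp)
    then have nE: "(cmod (E x t))\<^sup>2 = 1 / (T - t)"
      using t by (simp add: exp_minus divide_inverse)
    have lin_part: "\<i> * pt x t + pxx x t = E x t * (complex_of_real (1 / (T - t)\<^sup>2) * Q2 (x / (T - t)))"
      unfolding pt_def pxx_def \<tau>(1) by (simp add: algebra_simps)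
    have "\<i> * pt x t + pxx x t
          + ?c * complex_of_real (1 / x) * complex_of_real ((cmod (E x t * Q (x / (T - t))))\<^sup>2) * (E x t * Q (x / (T - t)))
          + complex_of_real (5 / 36) * complex_of_real (1 / x\<^sup>2) * (E x t * Q (x / (T - t)))
        = E x t * complex_of_real (1 / (T - t)\<^sup>2) * (Q2 (x / (T - t))
          + ?c * complex_of_real (1 / (x / (T - t)))
              * complex_of_real ((cmod (Q (x / (T - t))))\<^sup>2) * Q (x / (T - t))
          + complex_of_real (5/36) * complex_of_real (1 / (x / (T - t))\<^sup>2) * Q (x / (T - t)))"
      unfolding lin_part norm_mult power_mult_distrib nE \<tau>(1)
      using x \<tau>(2) by (simp add: field_simps power2_eq_square)
    then show "\<i> * pt x t + pxx x t
          + ?c * complex_of_real (1 / x) * complex_of_real ((cmod (E x t * Q (x / (T - t))))\<^sup>2) * (E x t * Q (x / (T - t)))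
          + complex_of_real (5 / 36) * complex_of_real (1 / x\<^sup>2) * (E x t * Q (x / (T - t))) = 0"
      unfolding steady[OF s] by simp
  qed

  have psi: "pseudoconformal T Q = (\<lambda>x t. if x > 0 then E x t * Q (x / (T - t)) else 0)"
    by (simp add: pseudoconformal_def E_def fun_eq_iff)
  show ?thesis
    unfolding classical_solution_def psi
  proof (intro exI conjI ballI)
    show "continuous_on ((- {0}) \<times> {0..<T}) (\<lambda>(x, t). if x > 0 then E x t * Q (x / (T - t)) else 0)"
      by (rule continuous_on_extend_zero[OF c0])
    show "continuous_on ((- {0}) \<times> {0..<T}) (\<lambda>(x, t). if x > 0 then pt x t else 0)"
      by (rule continuous_on_extend_zero[OF ct])
    show "continuous_on ((- {0}) \<times> {0..<T}) (\<lambda>(x, t). if x > 0 then px x t else 0)"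
      by (rule continuous_on_extend_zero[OF cx])
    show "continuous_on ((- {0}) \<times> {0..<T}) (\<lambda>(x, t). if x > 0 then pxx x t else 0)"
      by (rule continuous_on_extend_zero[OF cxx])
  next
    fix x t :: real assume "x \<in> - {0}" "t \<in> {0..<T}"
    then have x: "x \<noteq> 0" and t: "t < T" by auto
    show "((\<lambda>s. if x > 0 then E x s * Q (x / (T - s)) else 0) has_vector_derivative
        (if x > 0 then pt x t else 0)) (at t within {0..<T})"
      using main(1)[OF _ t] by (auto intro: has_vector_derivative_at_within)
    show "((\<lambda>y. if y > 0 then E y t * Q (y / (T - t)) else 0) has_vector_derivative
        (if x > 0 then px x t else 0)) (at x)"
      by (rule has_vector_derivative_extend_zero[OF x main(2)[OF _ t]])
    show "((\<lambda>y. if y > 0 then px y t else 0) has_vector_derivative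
        (if x > 0 then pxx x t else 0)) (at x)"
      by (rule has_vector_derivative_extend_zero[OF x main(3)[OF _ t]])
    show "\<i> * (if x > 0 then pt x t else 0) + (if x > 0 then pxx x t else 0)
          + ?c * complex_of_real (1 / x)
              * complex_of_real ((cmod (if x > 0 then E x t * Q (x / (T - t)) else 0))\<^sup>2)
              * (if x > 0 then E x t * Q (x / (T - t)) else 0)
          + complex_of_real (5 / 36) * complex_of_real (1 / x\<^sup>2)
              * (if x > 0 then E x t * Q (x / (T - t)) else 0) = 0"
      using main(4)[OF _ t, of x] by (cases "x > 0") simp_all
  qed
qed

lemma norm_pseudoconformal:
  assumes "t < T"
  shows "cmod (pseudoconformal T Q x t)
    = (if x > 0 then (T - t) powr (-1/2) * cmod (Q (x / (T - t))) else 0)"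
  using assms by (simp add: pseudoconformal_def norm_mult powr_def)

section \<open>Bounds for the essential supremum\<close>

lemma Linf_norm_upper:
  assumes "\<And>x. x \<ge> 0 \<Longrightarrow> cmod (u x) \<le> C"
    and "(\<lambda>x. cmod (u x)) \<in> borel_measurable (lebesgue_on {0..})"
  shows "Linf_norm u \<le> ereal C"
  unfolding Linf_norm_def
  using assms by (intro esssup_I) (auto intro!: AE_I2)

text \<open>
  A lower bound at one point says nothing about an essential supremum; on an interval of positive
  length it does.
\<close>

lemma Linf_norm_lower:
  assumes "0 \<le> a" "a < b" and m: "\<And>x. a \<le> x \<Longrightarrow> x \<le> b \<Longrightarrow> m \<le> cmod (u x)"
  shows "ereal m \<le> Linf_norm u"
proof (rule ccontr)
  assume "\<not> ereal m \<le> Linf_norm u"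
  then have less: "Linf_norm u < ereal m" by simp
  have "AE x in lebesgue_on {0..}. ereal (cmod (u x)) \<le> Linf_norm u"
    unfolding Linf_norm_def by (rule esssup_AE)
  then have "AE x in lebesgue_on {0..}. x \<notin> {a..b}"
  proof (rule AE_mp, intro AE_I2 impI notI)
    fix x assume "ereal (cmod (u x)) \<le> Linf_norm u" "x \<in> {a..b}"
    then show False using m[of x] less
      by (metis atLeastAtMost_iff ereal_less_eq(3) leD order.trans)
  qed
  then have "emeasure (lebesgue_on {0..}) {a..b} = 0"
    by (subst (asm) AE_iff_measurable[of "{a..b}"])
       (use assms(1) in \<open>auto simp: sets_restrict_space_iff\<close>)
  moreover have "emeasure (lebesgue_on {0..}) {a..b} = ennreal (b - a)"
    using assms by (subst emeasure_restrict_space) auto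
  ultimately show False using assms by simp
qed

section \<open>Blow-up\<close>

theorem theorem2:
  fixes \<epsilon> \<gamma> T :: real
  assumes "\<epsilon> \<in> {1, -1}" and "\<gamma> \<noteq> 0" and "T > 0"
  shows "\<exists>\<psi> :: real \<Rightarrow> real \<Rightarrow> complex.
    classical_solution \<epsilon> \<gamma> T \<psi> \<and>
    (\<forall>t\<in>{0..<T}. Linf_norm (\<lambda>x. \<psi> x t) < \<infinity>) \<and>
    ((\<lambda>t. Linf_norm (\<lambda>x. \<psi> x t)) \<longlongrightarrow> \<infinity>) (at_left T)"
proof -
  obtain A \<beta> :: real where A: "A > 0" and
    rel: "Complex (-1) \<beta> * (Complex (-1) \<beta> - 1)
       + 9/4 * (complex_of_real \<epsilon> + \<i> * complex_of_real \<gamma>) * complex_of_real (A\<^sup>2) = 0"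
    using amplitude_phase_exist[OF \<open>\<gamma> \<noteq> 0\<close>] .
  define w where "w = power_profile A (Complex (-1) \<beta>)"
  define Q where "Q = emden w"
  define \<psi> where "\<psi> = pseudoconformal T Q"
  note power = autonomous_power_solution[OF rel]
  note steady = steady_state_of_autonomous[OF power, folded w_def, folded Q_def]
  have sol: "classical_solution \<epsilon> \<gamma> T \<psi>"
    unfolding \<psi>_def by (rule pseudoconformal_classical_solution[OF steady])
  have nQ: "cmod (Q s) = A * s powr (1/6) / (1 + s powr (2/3))" if "s > 0" for s
  proof -
    have "s powr (2/3) > -1" using powr_ge_zero[of s "2/3"] by linarith
    from norm_power_profile[OF this, of A \<beta>] show ?thesis
      using A by (simp add: Q_def emden_def w_def)
  qed
  have n\<psi>: "cmod (\<psi> x t) = (T - t) powr (-1/2) * (A * (x / (T - t)) powr (1/6) / (1 + (x / (T - t)) powr (2/3)))"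
    if "x > 0" "t < T" for x t
    using that by (simp add: \<psi>_def norm_pseudoconformal nQ)
  have meas: "(\<lambda>x. cmod (\<psi> x t)) \<in> borel_measurable (lebesgue_on {0..})" if "t < T" for t
  proof -
    have "(\<lambda>x. if x > 0 then (T - t) powr (-1/2) * (A * (x / (T - t)) powr (1/6) / (1 + (x / (T - t)) powr (2/3))) else 0)
        \<in> borel_measurable borel"
      by measurable
    also have "(\<lambda>x. if x > 0 then (T - t) powr (-1/2) * (A * (x / (T - t)) powr (1/6) / (1 + (x / (T - t)) powr (2/3))) else 0)
        = (\<lambda>x. cmod (\<psi> x t))"
      using that n\<psi> by (auto simp: \<psi>_def norm_pseudoconformal nQ)
    finally show ?thesis
      by (intro measurable_restrict_space1 measurable_completion) simp
  qed
  have upper: "Linf_norm (\<lambda>x. \<psi> x t) \<le> ereal ((T - t) powr (-1/2) * A)" if "t < T" for t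
  proof (rule Linf_norm_upper[OF _ meas[OF that]])
    fix x :: real assume "x \<ge> 0"
    show "cmod (\<psi> x t) \<le> (T - t) powr (-1/2) * A"
    proof (cases "x > 0")
      case True
      define s where "s = x / (T - t)"
      have s: "s > 0" using True that by (simp add: s_def)
      have "s powr (1/6) \<le> 1 + s powr (2/3)"
      proof (cases "s \<le> 1")
        case True
        then have "s powr (1/6) \<le> 1" using s by (simp add: powr_le_one_le powr_le1)
        then show ?thesis using powr_ge_zero[of s "2/3"] by linarith
      next
        case False
        then have "s powr (1/6) \<le> s powr (2/3)" by (intro powr_mono) auto
        then show ?thesis by linarith
      qed
      moreover have "1 + s powr (2/3) > 0" using s by (simp add: add_pos_pos)
      ultimately have "A * s powr (1/6) / (1 + s powr (2/3)) \<le> A"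
        using A by (simp add: pos_divide_le_eq)
      then show ?thesis
        unfolding n\<psi>[OF True that] s_def by (intro mult_left_mono) auto
    qed (use A in \<open>simp add: \<psi>_def pseudoconformal_def\<close>)
  qed
  \<comment> \<open>In the self-similar variable \<open>s = x / (T - t)\<close> the interval is \<open>[1, 2]\<close>, where
      \<open>s\<^sup>1\<^sup>/\<^sup>6 \<ge> 1\<close> and \<open>1 + s\<^sup>2\<^sup>/\<^sup>3 \<le> 3\<close>.\<close>
  have lower: "ereal ((T - t) powr (-1/2) * (A / 3)) \<le> Linf_norm (\<lambda>x. \<psi> x t)" if "t < T" for t
  proof (rule Linf_norm_lower[of "T - t" "2 * (T - t)"])
    fix x assume x: "T - t \<le> x" "x \<le> 2 * (T - t)"
    define s where "s = x / (T - t)"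
    have s: "1 \<le> s" "s \<le> 2" using x that by (simp_all add: s_def field_simps)
    have "s powr (2/3) \<le> s powr 1" using s by (intro powr_mono) auto
    then have "s powr (2/3) \<le> 2" using s by simp
    moreover have "1 \<le> s powr (1/6)" using s by (simp add: ge_one_powr_ge_zero)
    ultimately have "A * 1 / 3 \<le> A * s powr (1/6) / (1 + s powr (2/3))"
      using A by (intro frac_le mult_left_mono) (auto simp: add_pos_nonneg)
    moreover have "x > 0" using x that by linarith
    ultimately show "(T - t) powr (-1/2) * (A / 3) \<le> cmod (\<psi> x t)"
      using that by (simp only: n\<psi> s_def) (intro mult_left_mono, simp_all)
  qed (use that in auto)
  have "filterlim (\<lambda>t. (T - t) powr (-1/2) * (A / 3)) at_top (at_left T)"
  proof -
    have "((\<lambda>t. sqrt (T - t)) \<longlongrightarrow> 0) (at_left T)"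
      by (auto intro!: tendsto_eq_intros)
    then have "filterlim (\<lambda>t. inverse (sqrt (T - t))) at_top (at_left T)"
      by (rule filterlim_inverse_at_top) (auto simp: eventually_at_filter)
    moreover have "inverse (sqrt (T - t)) = (T - t) powr (-1/2)" if "t < T" for t
      using that powr_minus[of "T - t" "1/2"] powr_half_sqrt[of "T - t"] by simp
    then have "eventually (\<lambda>t. inverse (sqrt (T - t)) = (T - t) powr (-1/2)) (at_left T)"
      by (simp add: eventually_at_filter)
    ultimately have "filterlim (\<lambda>t. (T - t) powr (-1/2)) at_top (at_left T)"
      by (rule filterlim_mono_eventually[OF _ order_refl order_refl])
    then show ?thesis
      using A by (intro filterlim_at_top_mult_tendsto_pos[OF tendsto_const, of "A / 3"]) auto
  qed
  then have lim: "((\<lambda>t. ereal ((T - t) powr (-1/2) * (A / 3))) \<longlongrightarrow> \<infinity>) (at_left T)"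
    by (simp add: tendsto_PInfty_eq_at_top)
  have "eventually (\<lambda>t. ereal ((T - t) powr (-1/2) * (A / 3)) \<le> Linf_norm (\<lambda>x. \<psi> x t)) (at_left T)"
    unfolding eventually_at_filter using lower by (intro always_eventually) simp
  from this _ lim tendsto_const have "((\<lambda>t. Linf_norm (\<lambda>x. \<psi> x t)) \<longlongrightarrow> \<infinity>) (at_left T)"
    by (rule tendsto_sandwich) simp
  moreover have "Linf_norm (\<lambda>x. \<psi> x t) < \<infinity>" if "t \<in> {0..<T}" for t
    using upper[of t] that by auto
  ultimately show ?thesis using sol by blast
qed

end
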